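(* Let $\mathcal V$ be a finite set of states, $E:\mathcal V\to\mathbb R$ an energy function, and $w$ a real antisymmetric function, $w(x,y)=-w(y,x)$, with $E$ and $w$ not depending on $\beta$. Let $k_{\mathrm{eq}}(x,y)$ be irreducible transition rates, depending smoothly on the inverse temperature $\beta>0$ and satisfying detailed balance with respect to $\rho_{\mathrm{eq}}(x)\propto e^{-\beta E(x)}$. Then the McLennan (close-to-equilibrium) heat capacity $$C_{\mathrm{ML}}(\beta)=\beta\big(\langle E\rangle_{\mathrm{eq}}-\langle E\rangle_{\mathrm{ML}}\big)-\beta^2\,\frac{\partial}{\partial\beta}\langle E\rangle_{\mathrm{ML}}$$ is obtained from the McLennan entropy $S_{\mathrm{ML}}=-\sum_x\rho_{\mathrm{ML}}(x)\log\rho_{\mathrm{ML}}(x)$, to linear order in $\varepsilon$: for every fixed $\beta>0$, $$C_{\mathrm{ML}}(\beta)=-\beta\,\frac{\partial S_{\mathrm{ML}}}{\partial\beta}+O(\varepsilon^2)\qquad\text{as }\varepsilon\to0 .$$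
   Context: Detailed balance means $k_{\mathrm{eq}}(x,y)\rho_{\mathrm{eq}}(x)=k_{\mathrm{eq}}(y,x)\rho_{\mathrm{eq}}(y)$ for all $x,y$, with $\rho_{\mathrm{eq}}(x)=e^{-\beta E(x)}/\sum_y e^{-\beta E(y)}$. The equilibrium backward generator is $L_{\mathrm{eq}}f(x)=\sum_y k_{\mathrm{eq}}(x,y)[f(y)-f(x)]$, and $\langle f\rangle_{\mathrm{eq}}=\sum_x f(x)\rho_{\mathrm{eq}}(x)$. For real $\varepsilon$, $W$ (depending on $\beta$ and $\varepsilon$) is the unique solution of the Poisson equation $$L_{\mathrm{eq}}W(x)=-\varepsilon\sum_y k_{\mathrm{eq}}(x,y)\,w(x,y)\quad\text{for all }x,\qquad \langle W\rangle_{\mathrm{eq}}=0 .$$ The McLennan distribution is $\rho_{\mathrm{ML}}(x)=\rho_{\mathrm{eq}}(x)\,(1-\beta W(x))$; it is normalized, and it is strictly positive for $|\varepsilon|$ small enough (at $\beta$ in a neighbourhood of any fixed value). Expectations are $\langle f\rangle_{\mathrm{ML}}=\sum_x f(x)\rho_{\mathrm{ML}}(x)$. *)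

theory Defs
  imports "HOL-Analysis.Analysis" "HOL-Library.Landau_Symbols"
begin

definition gibbs :: "('v::finite \<Rightarrow> real) \<Rightarrow> real \<Rightarrow> 'v \<Rightarrow> real" where
  "gibbs E \<beta> x = exp (- \<beta> * E x) / (\<Sum>y\<in>UNIV. exp (- \<beta> * E y))"

definition mean :: "('v::finite \<Rightarrow> real) \<Rightarrow> ('v \<Rightarrow> real) \<Rightarrow> real" where
  "mean \<rho> f = (\<Sum>x\<in>UNIV. f x * \<rho> x)"

definition detailed_balance :: "('v \<Rightarrow> 'v \<Rightarrow> real) \<Rightarrow> ('v \<Rightarrow> real) \<Rightarrow> bool" where
  "detailed_balance k \<rho> \<longleftrightarrow> (\<forall>x y. k x y * \<rho> x = k y x * \<rho> y)"

(* The diagonal of k is left free: it enters the generator only multiplied by f x - f x,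
   and the source term only multiplied by w x x = 0. *)
definition transition_rates :: "('v \<Rightarrow> 'v \<Rightarrow> real) \<Rightarrow> bool" where
  "transition_rates k \<longleftrightarrow> (\<forall>x y. x \<noteq> y \<longrightarrow> 0 \<le> k x y)"

definition irreducible_rates :: "('v \<Rightarrow> 'v \<Rightarrow> real) \<Rightarrow> bool" where
  "irreducible_rates k \<longleftrightarrow> (\<forall>x y. (x, y) \<in> {(u, v). u \<noteq> v \<and> 0 < k u v}\<^sup>*)"

(* C-infinity on a set S, meant for open S: derivatives of every order exist on S. *)
definition smooth_on :: "real set \<Rightarrow> (real \<Rightarrow> real) \<Rightarrow> bool" where
  "smooth_on S f \<longleftrightarrow> (\<forall>n. \<forall>t\<in>S. (deriv ^^ n) f field_differentiable at t)"

definition generator :: "('v::finite \<Rightarrow> 'v \<Rightarrow> real) \<Rightarrow> ('v \<Rightarrow> real) \<Rightarrow> 'v \<Rightarrow> real" where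
  "generator k f x = (\<Sum>y\<in>UNIV. k x y * (f y - f x))"

definition poisson_solution ::
    "(real \<Rightarrow> 'v::finite \<Rightarrow> 'v \<Rightarrow> real) \<Rightarrow> ('v \<Rightarrow> real) \<Rightarrow> ('v \<Rightarrow> 'v \<Rightarrow> real) \<Rightarrow> real \<Rightarrow> real
      \<Rightarrow> ('v \<Rightarrow> real) \<Rightarrow> bool" where
  "poisson_solution k E w \<epsilon> \<beta> W \<longleftrightarrow>
     (\<forall>x. generator (k \<beta>) W x = - \<epsilon> * (\<Sum>y\<in>UNIV. k \<beta> x y * w x y)) \<and>
     mean (gibbs E \<beta>) W = 0"

definition W_ML ::
    "(real \<Rightarrow> 'v::finite \<Rightarrow> 'v \<Rightarrow> real) \<Rightarrow> ('v \<Rightarrow> real) \<Rightarrow> ('v \<Rightarrow> 'v \<Rightarrow> real) \<Rightarrow> real \<Rightarrow> real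
      \<Rightarrow> 'v \<Rightarrow> real" where
  "W_ML k E w \<epsilon> \<beta> = (THE W. poisson_solution k E w \<epsilon> \<beta> W)"

definition rho_ML ::
    "(real \<Rightarrow> 'v::finite \<Rightarrow> 'v \<Rightarrow> real) \<Rightarrow> ('v \<Rightarrow> real) \<Rightarrow> ('v \<Rightarrow> 'v \<Rightarrow> real) \<Rightarrow> real \<Rightarrow> real
      \<Rightarrow> 'v \<Rightarrow> real" where
  "rho_ML k E w \<epsilon> \<beta> x = gibbs E \<beta> x * (1 - \<beta> * W_ML k E w \<epsilon> \<beta> x)"

definition energy_ML ::
    "(real \<Rightarrow> 'v::finite \<Rightarrow> 'v \<Rightarrow> real) \<Rightarrow> ('v \<Rightarrow> real) \<Rightarrow> ('v \<Rightarrow> 'v \<Rightarrow> real) \<Rightarrow> real \<Rightarrow> real \<Rightarrow> real" where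
  "energy_ML k E w \<epsilon> \<beta> = mean (rho_ML k E w \<epsilon> \<beta>) E"

definition C_ML ::
    "(real \<Rightarrow> 'v::finite \<Rightarrow> 'v \<Rightarrow> real) \<Rightarrow> ('v \<Rightarrow> real) \<Rightarrow> ('v \<Rightarrow> 'v \<Rightarrow> real) \<Rightarrow> real \<Rightarrow> real \<Rightarrow> real" where
  "C_ML k E w \<epsilon> \<beta> =
     \<beta> * (mean (gibbs E \<beta>) E - energy_ML k E w \<epsilon> \<beta>) - \<beta>\<^sup>2 * deriv (\<lambda>b. energy_ML k E w \<epsilon> b) \<beta>"

definition S_ML ::
    "(real \<Rightarrow> 'v::finite \<Rightarrow> 'v \<Rightarrow> real) \<Rightarrow> ('v \<Rightarrow> real) \<Rightarrow> ('v \<Rightarrow> 'v \<Rightarrow> real) \<Rightarrow> real \<Rightarrow> real \<Rightarrow> real" where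
  "S_ML k E w \<epsilon> \<beta> = - (\<Sum>x\<in>UNIV. rho_ML k E w \<epsilon> \<beta> x * ln (rho_ML k E w \<epsilon> \<beta> x))"

end

theory Submission
  imports Defs
begin

text \<open>
  By linearity \<open>W = \<epsilon> u\<^sub>\<beta>\<close>, where \<open>u\<^sub>\<beta>\<close> solves an invertible linear system whose coefficients are
  differentiable in \<open>\<beta>\<close>; by Cramer's rule \<open>u\<^sub>\<beta>\<close> is differentiable too. Writing \<open>c = \<beta> u\<^sub>\<beta>\<close> and \<open>g\<close> for
  the Gibbs weights, \<open>\<rho>\<^sub>M\<^sub>L = g (1 - \<epsilon> c)\<close> and \<open>ln \<rho>\<^sub>M\<^sub>L = - \<beta> E - ln Z + ln (1 - \<epsilon> c)\<close>. Since the
  derivative of \<open>\<rho>\<^sub>M\<^sub>L\<close> sums to zero, \<open>C\<^sub>M\<^sub>L + \<beta> S'\<^sub>M\<^sub>L\<close> equals \<open>\<beta>\<close> times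
  \<open>\<langle>E\<rangle>\<^sub>e\<^sub>q - \<langle>E\<rangle>\<^sub>M\<^sub>L - \<Sum> \<rho>'\<^sub>M\<^sub>L ln (1 - \<epsilon> c)\<close>. The first-order terms cancel because
  \<open>g' = - (E - \<langle>E\<rangle>\<^sub>e\<^sub>q) g\<close> and \<open>c\<close> has equilibrium mean zero.
\<close>

section \<open>Gibbs weights and their derivative in the inverse temperature\<close>

lemma gibbs_pos: "0 < gibbs E b x"
  unfolding gibbs_def by (intro divide_pos_pos sum_pos) auto

lemma sum_gibbs: "(\<Sum>x\<in>UNIV. gibbs E b x) = 1"
proof -
  have "(\<Sum>y\<in>UNIV. exp (- b * E y)) > 0"
    by (intro sum_pos) auto
  then show ?thesis
    unfolding gibbs_def sum_divide_distrib[symmetric] by simp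
qed

lemma gibbs_has_derivative:
  "((\<lambda>b. gibbs E b x) has_real_derivative - (E x - mean (gibbs E b) E) * gibbs E b x) (at b)"
proof -
  define Z where "Z b = (\<Sum>y\<in>UNIV. exp (- b * E y))" for b
  have Zpos: "Z b > 0" for b
    unfolding Z_def by (intro sum_pos) auto
  have dZ: "(Z has_real_derivative (\<Sum>y\<in>UNIV. - E y * exp (- b * E y))) (at b)"
    unfolding Z_def by (auto intro!: derivative_eq_intros sum.cong)
  have m: "mean (gibbs E b) E = (\<Sum>y\<in>UNIV. E y * exp (- b * E y)) / Z b"
    unfolding mean_def gibbs_def Z_def by (simp add: sum_divide_distrib)
  have g: "gibbs E b x = exp (- b * E x) / Z b" for b
    unfolding gibbs_def Z_def by simp
  have "((\<lambda>b. exp (- b * E x) / Z b) has_real_derivative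
      (- E x * exp (- b * E x) * Z b - exp (- b * E x) * (\<Sum>y\<in>UNIV. - E y * exp (- b * E y)))
        / (Z b * Z b)) (at b)"
    by (rule DERIV_divide[OF _ dZ]) (use Zpos[of b] in \<open>auto intro!: derivative_eq_intros\<close>)
  also have "(- E x * exp (- b * E x) * Z b - exp (- b * E x) * (\<Sum>y\<in>UNIV. - E y * exp (- b * E y)))
        / (Z b * Z b) = - (E x - mean (gibbs E b) E) * gibbs E b x"
    unfolding m g using Zpos[of b] by (simp add: field_simps sum_negf)
  finally show ?thesis
    unfolding g .
qed

section \<open>Detailed balance and invertibility of the centred generator\<close>

text \<open>Exchanging x and y keeps the weight \<open>k x y * \<rho> x\<close> and reverses the
  sign of \<open>F\<close>, so the double sum equals its own negative. With
  \<open>F x y = f y - f x\<close> this gives mean zero for the image of the generator; with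
  \<open>F = w\<close> it does so for the source of the Poisson equation.\<close>

lemma detailed_balance_sum_antisymmetric:
  fixes F :: "'v::finite \<Rightarrow> 'v \<Rightarrow> real"
  assumes "detailed_balance k \<rho>" and "\<And>x y. F x y = - F y x"
  shows "mean \<rho> (\<lambda>x. \<Sum>y\<in>UNIV. k x y * F x y) = 0"
proof -
  have mean_eq: "mean \<rho> (\<lambda>x. \<Sum>y\<in>UNIV. k x y * F x y) = (\<Sum>x\<in>UNIV. \<Sum>y\<in>UNIV. (k x y * \<rho> x) * F x y)"
    unfolding mean_def sum_distrib_right by (simp add: mult_ac)
  have "\<dots> = (\<Sum>x\<in>UNIV. \<Sum>y\<in>UNIV. (k y x * \<rho> y) * - F y x)"
    using assms unfolding detailed_balance_def by (intro sum.cong) metis+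
  also have "\<dots> = - (\<Sum>y\<in>UNIV. \<Sum>x\<in>UNIV. (k y x * \<rho> y) * F y x)"
    by (subst sum.swap) (simp add: sum_negf)
  finally show ?thesis
    unfolding mean_eq by simp
qed

text \<open>Maximum principle: the set where \<open>f\<close> is maximal is closed under allowed transitions.\<close>

lemma generator_kernel_constant:
  fixes f :: "'v::finite \<Rightarrow> real"
  assumes "transition_rates k" and "irreducible_rates k" and "\<And>x. generator k f x = 0"
  shows "f x = f y"
proof -
  define m where "m = Max (range f)"
  have le: "f z \<le> m" for z
    unfolding m_def by simp
  have "m \<in> range f"
    unfolding m_def by (intro Max_in) auto
  then obtain x0 where x0: "f x0 = m"
    by auto
  have step: "f v = m" if "f u = m" "u \<noteq> v" "0 < k u v" for u v
  proof -
    \<comment> \<open>The term \<open>z = u\<close> vanishes because \<open>f u = m\<close>; every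
      other rate is nonnegative.\<close>
    have nonneg: "0 \<le> k u z * (m - f z)" for z
      using assms(1) le[of z] \<open>f u = m\<close> unfolding transition_rates_def
      by (cases "u = z") auto
    \<comment> \<open>At a maximum the equation for \<open>f\<close> is a vanishing sum of
      nonnegative terms, so each term vanishes and a positive rate forces
      \<open>f v = m\<close>.\<close>
    have "(\<Sum>z\<in>UNIV. k u z * (m - f z)) = - generator k f u"
      unfolding generator_def sum_negf[symmetric]
      by (intro sum.cong) (auto simp: \<open>f u = m\<close> algebra_simps)
    then have "(\<Sum>z\<in>UNIV. k u z * (m - f z)) = 0"
      using assms(3) by simp
    then have "k u v * (m - f v) = 0"
      using nonneg by (subst (asm) sum_nonneg_eq_0_iff) auto
    then show ?thesis
      using \<open>0 < k u v\<close> by simp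
  qed
  have "f z = m" for z
  proof -
    have "(x0, z) \<in> {(u, v). u \<noteq> v \<and> 0 < k u v}\<^sup>*"
      using assms(2) unfolding irreducible_rates_def by blast
    then show ?thesis
      by (induction rule: rtrancl_induct) (use x0 step in auto)
  qed
  then show ?thesis
    by simp
qed

text \<open>Subtracting the equilibrium mean makes the generator invertible and encodes the
  normalization of the Poisson equation.\<close>

definition centred_generator :: "('v::finite \<Rightarrow> 'v \<Rightarrow> real) \<Rightarrow> ('v \<Rightarrow> real) \<Rightarrow> real ^ 'v ^ 'v" where
  "centred_generator k \<rho> = (\<chi> x y. k x y - (if x = y then (\<Sum>z\<in>UNIV. k x z) else 0) - \<rho> y)"

lemma centred_generator_mult:
  "(centred_generator k \<rho> *v f) $ x = generator k (($) f) x - mean \<rho> (($) f)"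
proof -
  have "(centred_generator k \<rho> *v f) $ x
      = (\<Sum>y\<in>UNIV. k x y * f $ y - (if x = y then (\<Sum>z\<in>UNIV. k x z) * f $ x else 0) - f $ y * \<rho> y)"
    unfolding centred_generator_def matrix_vector_mult_def
    by (simp, intro sum.cong) (auto simp: algebra_simps)
  also have "\<dots> = generator k (($) f) x - mean \<rho> (($) f)"
    unfolding generator_def mean_def
    by (simp add: sum_subtractf right_diff_distrib sum_distrib_right)
  finally show ?thesis .
qed

lemma mean_generator:
  assumes "detailed_balance k \<rho>"
  shows "mean \<rho> (generator k f) = 0"
  using detailed_balance_sum_antisymmetric[OF assms, of "\<lambda>x y. f y - f x"]
  unfolding generator_def by simp

lemma mean_diff_const:
  "mean (gibbs E b) (\<lambda>x. f x - c) = mean (gibbs E b) f - c"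
  unfolding mean_def by (simp add: left_diff_distrib sum_subtractf sum_distrib_left[symmetric] sum_gibbs)

text \<open>Averaging the matrix equation against the Gibbs weights kills both the generator term
  and the source. This leaves mean zero for \<open>f\<close>, and the subtracted mean then drops out
  of the equation.\<close>

lemma centred_generator_solution_iff:
  fixes f s :: "real ^ 'v"
  assumes "detailed_balance k (gibbs E b)" and "mean (gibbs E b) (($) s) = 0"
  shows "centred_generator k (gibbs E b) *v f = s \<longleftrightarrow>
    (\<forall>x. generator k (($) f) x = s $ x) \<and> mean (gibbs E b) (($) f) = 0"
proof
  assume L: "centred_generator k (gibbs E b) *v f = s"
  then have eq: "generator k (($) f) x - mean (gibbs E b) (($) f) = s $ x" for x
    by (simp add: centred_generator_mult[symmetric])
  then have "($) s = (\<lambda>x. generator k (($) f) x - mean (gibbs E b) (($) f))"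
    by auto
  then have "mean (gibbs E b) (($) f) = 0"
    using assms(2) mean_generator[OF assms(1)] by (simp add: mean_diff_const)
  with eq show "(\<forall>x. generator k (($) f) x = s $ x) \<and> mean (gibbs E b) (($) f) = 0"
    by simp
qed (simp add: vec_eq_iff centred_generator_mult)

text \<open>A kernel vector is harmonic with mean zero; harmonic functions are constant, and a
  constant equals its mean.\<close>

lemma det_centred_generator:
  assumes "transition_rates k" and "irreducible_rates k" and "detailed_balance k (gibbs E b)"
  shows "det (centred_generator k (gibbs E b)) \<noteq> 0"
proof -
  have "f = 0" if "centred_generator k (gibbs E b) *v f = 0" for f
  proof -
    have L: "generator k (($) f) x = 0" and M: "mean (gibbs E b) (($) f) = 0" for x
      using that centred_generator_solution_iff[OF assms(3), of 0 f] by (auto simp: mean_def)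
    have "f $ x = f $ y" for x y
      using generator_kernel_constant[OF assms(1,2) L] .
    then have "mean (gibbs E b) (($) f) = f $ y" for y
      unfolding mean_def
      by (metis (no_types, lifting) mult.right_neutral sum.cong sum_distrib_left sum_gibbs)
    with M show ?thesis
      by (simp add: vec_eq_iff)
  qed
  then show ?thesis
    by (metis invertible_det_nz invertible_left_inverse matrix_left_invertible_ker)
qed

section \<open>The Poisson equation solved by Cramer's rule\<close>

text \<open>Cramer's quotient for the solution at \<epsilon> = 1. Unlike the \<open>THE\<close> in
  \<open>W_ML\<close>, this formula makes the dependence on \<open>b\<close> explicit.\<close>

definition poisson_unit ::
    "(real \<Rightarrow> 'v::finite \<Rightarrow> 'v \<Rightarrow> real) \<Rightarrow> ('v \<Rightarrow> real) \<Rightarrow> ('v \<Rightarrow> 'v \<Rightarrow> real) \<Rightarrow> real \<Rightarrow> 'v \<Rightarrow> real"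
  where
  "poisson_unit k E w b z =
     det (\<chi> x y. if y = z then - (\<Sum>y\<in>UNIV. k b x y * w x y)
                else centred_generator (k b) (gibbs E b) $ x $ y)
       / det (centred_generator (k b) (gibbs E b))"

lemma mean_scale: "mean \<rho> (\<lambda>x. c * f x) = c * mean \<rho> f"
  unfolding mean_def by (simp add: sum_distrib_left algebra_simps)

text \<open>The source has equilibrium mean zero, so the Poisson problem is one square system with
  nonzero determinant. Its right-hand side is proportional to \<epsilon>, so the solution at
  \<epsilon> = 1 only has to be scaled.\<close>

lemma poisson_solution_iff_unit:
  assumes "transition_rates (k b)" and "irreducible_rates (k b)"
    and db: "detailed_balance (k b) (gibbs E b)" and "\<And>x y. w x y = - w y x"
  shows "poisson_solution k E w \<epsilon> b W \<longleftrightarrow> W = (\<lambda>x. \<epsilon> * poisson_unit k E w b x)"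
proof -
  define A where "A = centred_generator (k b) (gibbs E b)"
  define s where "s = (\<chi> x. - (\<Sum>y\<in>UNIV. k b x y * w x y))"
  have det: "det A \<noteq> 0"
    unfolding A_def using det_centred_generator assms by blast
  have "mean (gibbs E b) (($) (c *\<^sub>R s)) = 0" for c
    using detailed_balance_sum_antisymmetric[where F = w, OF db assms(4)]
      mean_scale[of "gibbs E b" "- c" "\<lambda>x. \<Sum>y\<in>UNIV. k b x y * w x y"]
    unfolding s_def by (simp add: mean_def)
  then have "poisson_solution k E w \<epsilon> b W \<longleftrightarrow> A *v (\<chi> x. W x) = \<epsilon> *\<^sub>R s"
    using centred_generator_solution_iff[OF db, of "\<epsilon> *\<^sub>R s" "\<chi> x. W x"]
    unfolding poisson_solution_def A_def s_def by (simp add: vec_lambda_inverse)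
  moreover have "A *v (\<chi> x. poisson_unit k E w b x) = s"
    unfolding cramer[OF det] unfolding poisson_unit_def A_def s_def
    by (simp add: vec_eq_iff cong: if_cong)
  then have "A *v (\<chi> x. \<epsilon> * poisson_unit k E w b x) = \<epsilon> *\<^sub>R s"
    by (simp add: vec_eq_iff matrix_vector_mult_def algebra_simps sum_distrib_left[symmetric])
  \<comment> \<open>Uniqueness: both vectors are the same Cramer quotient.\<close>
  moreover have "A *v v = A *v v' \<longleftrightarrow> v = v'" for v v'
    using cramer[OF det, of v "A *v v'"] cramer[OF det, of v' "A *v v'"] by metis
  ultimately show ?thesis
    by (metis (no_types, lifting) ext vec_lambda_beta)
qed

lemma W_ML_eq:
  assumes "transition_rates (k b)" and "irreducible_rates (k b)"
    and "detailed_balance (k b) (gibbs E b)" and "\<And>x y. w x y = - w y x"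
  shows "W_ML k E w \<epsilon> b = (\<lambda>x. \<epsilon> * poisson_unit k E w b x)"
  unfolding W_ML_def poisson_solution_iff_unit[where k = k and b = b and w = w, OF assms] by simp

lemma mean_poisson_unit:
  assumes "transition_rates (k b)" and "irreducible_rates (k b)"
    and "detailed_balance (k b) (gibbs E b)" and "\<And>x y. w x y = - w y x"
  shows "mean (gibbs E b) (poisson_unit k E w b) = 0"
  using poisson_solution_iff_unit[where k = k and b = b and w = w, OF assms, of 1 "poisson_unit k E w b"]
  unfolding poisson_solution_def by simp

section \<open>Differentiability of the Poisson solution in the inverse temperature\<close>

lemma field_differentiable_prod:
  fixes f :: "'i \<Rightarrow> 'a::real_normed_field \<Rightarrow> 'a"
  assumes "\<And>i. i \<in> I \<Longrightarrow> f i field_differentiable (at z within S)"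
  shows "(\<lambda>x. \<Prod>i\<in>I. f i x) field_differentiable (at z within S)"
  using assms by (induction I rule: infinite_finite_induct) (auto intro: field_differentiable_mult)

text \<open>By the Leibniz formula the determinant is a polynomial in the entries.\<close>

lemma field_differentiable_det:
  fixes A :: "real \<Rightarrow> real ^ 'n ^ 'n"
  assumes "\<And>i j. (\<lambda>b. A b $ i $ j) field_differentiable (at z within S)"
  shows "(\<lambda>b. det (A b)) field_differentiable (at z within S)"
  unfolding det_def
  by (intro field_differentiable_sum field_differentiable_mult field_differentiable_prod
      field_differentiable_const assms)

lemma poisson_unit_differentiable:
  assumes "\<And>x y. (\<lambda>b. k b x y) field_differentiable at b"
    and "det (centred_generator (k b) (gibbs E b)) \<noteq> 0"
  shows "(\<lambda>b. poisson_unit k E w b z) field_differentiable at b"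
proof -
  have g: "(\<lambda>b. gibbs E b x) field_differentiable at b" for x
    using gibbs_has_derivative field_differentiable_def by blast
  have A: "(\<lambda>b. centred_generator (k b) (gibbs E b) $ x $ y) field_differentiable at b" for x y
    unfolding centred_generator_def
    by (cases "x = y")
       (auto intro!: field_differentiable_diff field_differentiable_sum assms(1) g)
  show ?thesis
    unfolding poisson_unit_def
  proof (intro field_differentiable_divide field_differentiable_det A assms(2))
    fix x y
    show "(\<lambda>b. (\<chi> x y. if y = z then - (\<Sum>y\<in>UNIV. k b x y * w x y)
        else centred_generator (k b) (gibbs E b) $ x $ y) $ x $ y) field_differentiable at b"
      by (cases "y = z") (auto intro!: field_differentiable_minus field_differentiable_sum
            field_differentiable_mult assms(1) A field_differentiable_const)
  qed
qed

section \<open>Expansion of the logarithm for small \<epsilon>\<close>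

lemma ln_one_minus_bigo:
  fixes c :: real
  shows "(\<lambda>\<epsilon>. ln (1 - \<epsilon> * c) + \<epsilon> * c) \<in> O[at 0](\<lambda>\<epsilon>. \<epsilon>\<^sup>2)"
    and "(\<lambda>\<epsilon>. ln (1 - \<epsilon> * c)) \<in> O[at 0](\<lambda>\<epsilon>. \<epsilon>)"
proof -
  have lim: "((\<lambda>\<epsilon>::real. \<bar>\<epsilon> * c\<bar>) \<longlongrightarrow> 0) (at 0)"
    by (auto intro!: tendsto_eq_intros)
  \<comment> \<open>The factor 2 comes from
    \<open>\<bar>ln (1 + x) - x\<bar> \<le> 2 * x\<^sup>2\<close> for
    \<open>\<bar>x\<bar> \<le> 1/2\<close>, taken at \<open>x = - (\<epsilon> * c)\<close>.\<close>
  have "\<forall>\<^sub>F \<epsilon> in at 0. norm (ln (1 - \<epsilon> * c) + \<epsilon> * c) \<le> (2 * c\<^sup>2) * norm (\<epsilon>\<^sup>2)"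
    using order_tendstoD(2)[OF lim, of "1/2", simplified]
  proof eventually_elim
    case (elim \<epsilon>)
    then show ?case
      using abs_ln_one_plus_x_minus_x_bound[of "- (\<epsilon> * c)"]
      by (simp add: power_mult_distrib mult_ac)
  qed
  then show 1: "(\<lambda>\<epsilon>. ln (1 - \<epsilon> * c) + \<epsilon> * c) \<in> O[at 0](\<lambda>\<epsilon>. \<epsilon>\<^sup>2)"
    by (rule bigoI)
  have "\<forall>\<^sub>F \<epsilon>::real in at 0. \<bar>\<epsilon>\<bar> < 1"
    by (rule order_tendstoD(2)[of _ 0]) (auto intro!: tendsto_eq_intros)
  then have "(\<lambda>\<epsilon>::real. \<epsilon>\<^sup>2) \<in> O[at 0](\<lambda>\<epsilon>. \<epsilon>)"
    by (intro bigoI[of _ 1]) (auto elim!: eventually_mono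
          simp: power2_eq_square abs_mult mult_left_le_one_le simp del: abs_mult_self_eq)
  with 1 have "(\<lambda>\<epsilon>. ln (1 - \<epsilon> * c) + \<epsilon> * c) \<in> O[at 0](\<lambda>\<epsilon>. \<epsilon>)"
    by (rule landau_o.big_trans)
  from sum_in_bigo(2)[OF this, of "\<lambda>\<epsilon>. \<epsilon> * c"]
  show "(\<lambda>\<epsilon>. ln (1 - \<epsilon> * c)) \<in> O[at 0](\<lambda>\<epsilon>. \<epsilon>)"
    by (auto intro!: bigoI[of _ "\<bar>c\<bar>"] simp: abs_mult)
qed

section \<open>Comparison of the heat capacity with the entropy derivative\<close>

theorem mainTheorem2:
  fixes E :: "'v::finite \<Rightarrow> real"
    and w :: "'v \<Rightarrow> 'v \<Rightarrow> real"
    and k :: "real \<Rightarrow> 'v \<Rightarrow> 'v \<Rightarrow> real"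
    and \<beta> :: real
  assumes antisym: "\<And>x y. w x y = - w y x"
    and rates: "\<And>b. 0 < b \<Longrightarrow> transition_rates (k b)"
    and irreducible: "\<And>b. 0 < b \<Longrightarrow> irreducible_rates (k b)"
    and balance: "\<And>b. 0 < b \<Longrightarrow> detailed_balance (k b) (gibbs E b)"
    and smooth: "\<And>x y. smooth_on {0<..} (\<lambda>b. k b x y)"
    and "0 < \<beta>"
  shows "(\<forall>\<^sub>F \<epsilon> in at 0.
            (\<lambda>b. energy_ML k E w \<epsilon> b) field_differentiable at \<beta> \<and>
            (\<lambda>b. S_ML k E w \<epsilon> b) field_differentiable at \<beta>) \<and>
         (\<lambda>\<epsilon>. C_ML k E w \<epsilon> \<beta> - (- \<beta> * deriv (\<lambda>b. S_ML k E w \<epsilon> b) \<beta>)) \<in> O[at 0](\<lambda>\<epsilon>. \<epsilon>\<^sup>2)"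
proof -
  let ?g = "gibbs E \<beta>"
  define u where "u = poisson_unit k E w"
  define g' where "g' x = - (E x - mean ?g E) * ?g x" for x
  define c where "c x = \<beta> * u \<beta> x" for x
  have W: "W_ML k E w \<epsilon> b = (\<lambda>x. \<epsilon> * u b x)" if "0 < b" for \<epsilon> b
    unfolding u_def by (intro W_ML_eq rates irreducible balance antisym that)
  have mean_u: "mean (gibbs E b) (u b) = 0" if "0 < b" for b
    unfolding u_def by (intro mean_poisson_unit rates irreducible balance antisym that)
  \<comment> \<open>The instance \<open>n = 0\<close> of \<open>smooth_on\<close>: the zeroth
    iterate of \<open>deriv\<close> is the function itself.\<close>
  have k_diff: "(\<lambda>b. k b x y) field_differentiable at \<beta>" for x y
    using smooth \<open>0 < \<beta>\<close> unfolding smooth_on_def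
    by (metis funpow_0 greaterThan_iff)
  have "det (centred_generator (k \<beta>) ?g) \<noteq> 0"
    using det_centred_generator rates irreducible balance \<open>0 < \<beta>\<close> by blast
  from poisson_unit_differentiable[OF k_diff this]
  have "(\<lambda>b. u b x) field_differentiable at \<beta>" for x
    unfolding u_def .
  then obtain u' where u': "((\<lambda>b. u b x) has_real_derivative u' x) (at \<beta>)" for x
    unfolding field_differentiable_def by metis
  have mean_c: "(\<Sum>x\<in>UNIV. c x * ?g x) = 0"
    using mean_u[OF \<open>0 < \<beta>\<close>] mean_scale[of ?g \<beta> "u \<beta>"]
    unfolding c_def mean_def by simp
  \<comment> \<open>\<open>D x\<close> is the derivative at \<beta> of
    \<open>b * u b x * gibbs E b x\<close>, so \<open>r'\<close> is the derivative of the McLennan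
    weights, affine in \<epsilon>.\<close>
  define D where "D x = c x * g' x + (u \<beta> x + \<beta> * u' x) * ?g x" for x
  define r' where "r' \<epsilon> x = g' x - \<epsilon> * D x" for \<epsilon> x
  have rho: "rho_ML k E w \<epsilon> b x = gibbs E b x * (1 - b * (\<epsilon> * u b x))" if "0 < b" for \<epsilon> b x
    using W[OF that] unfolding rho_ML_def by simp
  have "((\<lambda>b. gibbs E b x * (1 - b * (\<epsilon> * u b x))) has_real_derivative r' \<epsilon> x) (at \<beta>)" for \<epsilon> x
    by (rule derivative_eq_intros gibbs_has_derivative u' refl)+
       (simp add: r'_def D_def c_def g'_def algebra_simps)
  \<comment> \<open>The closed form of \<open>rho_ML\<close> is available for \<open>b > 0\<close>,
    an open set containing \<beta>, so the derivative carries over.\<close>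
  then have rho': "((\<lambda>b. rho_ML k E w \<epsilon> b x) has_real_derivative r' \<epsilon> x) (at \<beta>)" for \<epsilon> x
    by (rule has_field_derivative_transform_within_open[where S = "{0<..}"])
       (use \<open>0 < \<beta>\<close> rho in auto)
  have energy': "((\<lambda>b. energy_ML k E w \<epsilon> b) has_real_derivative (\<Sum>x\<in>UNIV. E x * r' \<epsilon> x)) (at \<beta>)"
    for \<epsilon>
    unfolding energy_ML_def mean_def
    by (intro DERIV_sum DERIV_cmult rho')
  \<comment> \<open>Total mass is 1 for every \<open>b > 0\<close>; differentiating this removes all
    constants, including \<open>ln Z\<close>, from the entropy derivative below.\<close>
  have sum_r': "(\<Sum>x\<in>UNIV. r' \<epsilon> x) = 0" for \<epsilon>
  proof -
    have "(\<Sum>x\<in>UNIV. rho_ML k E w \<epsilon> b x) = 1" if "0 < b" for b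
      using mean_u[OF that] mean_scale[of "gibbs E b" "b * \<epsilon>" "u b"] sum_gibbs[of E b]
      unfolding rho[OF that] mean_def
      by (simp add: right_diff_distrib sum_subtractf mult_ac)
    then have "((\<lambda>b. \<Sum>x\<in>UNIV. rho_ML k E w \<epsilon> b x) has_real_derivative 0) (at \<beta>)"
      using has_field_derivative_transform_within_open[of "\<lambda>_. 1" 0 \<beta> "{0<..}"] \<open>0 < \<beta>\<close>
      by simp
    moreover have "((\<lambda>b. \<Sum>x\<in>UNIV. rho_ML k E w \<epsilon> b x) has_real_derivative (\<Sum>x\<in>UNIV. r' \<epsilon> x)) (at \<beta>)"
      by (intro DERIV_sum rho')
    ultimately show ?thesis
      using DERIV_unique by blast
  qed
  \<comment> \<open>Finiteness of the state space gives one neighbourhood for all states; there the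
    McLennan weights at \<beta> are positive and their logarithms split.\<close>
  have small: "\<forall>\<^sub>F \<epsilon> in at 0. \<forall>x. 0 < 1 - \<epsilon> * c x"
  proof (rule eventually_all_finite)
    fix x
    show "\<forall>\<^sub>F \<epsilon> in at 0. 0 < 1 - \<epsilon> * c x"
      by (rule order_tendstoD(1)[of _ 1]) (auto intro!: tendsto_eq_intros)
  qed
  define Z where "Z = (\<Sum>y\<in>UNIV. exp (- \<beta> * E y))"
  have "Z > 0"
    unfolding Z_def by (intro sum_pos) auto
  have ln_g: "ln (?g x) = - \<beta> * E x - ln Z" for x
    unfolding gibbs_def Z_def[symmetric] using \<open>Z > 0\<close> by (simp add: ln_div)
  have S': "((\<lambda>b. S_ML k E w \<epsilon> b) has_real_derivative
      \<beta> * (\<Sum>x\<in>UNIV. E x * r' \<epsilon> x) - (\<Sum>x\<in>UNIV. r' \<epsilon> x * ln (1 - \<epsilon> * c x))) (at \<beta>)"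
    if pos: "\<forall>x. 0 < 1 - \<epsilon> * c x" for \<epsilon>
  proof -
    have rho_c: "rho_ML k E w \<epsilon> \<beta> x = ?g x * (1 - \<epsilon> * c x)" for x
      using rho[OF \<open>0 < \<beta>\<close>] by (simp add: c_def mult_ac)
    then have rho_pos: "0 < rho_ML k E w \<epsilon> \<beta> x" for x
      using pos gibbs_pos[of E \<beta> x] by (simp add: zero_less_mult_iff)
    have ln_rho: "ln (rho_ML k E w \<epsilon> \<beta> x) = - \<beta> * E x - ln Z + ln (1 - \<epsilon> * c x)" for x
      unfolding rho_c using pos[rule_format, of x] gibbs_pos[of E \<beta> x]
      by (simp add: ln_mult ln_g)
    have "((\<lambda>b. rho_ML k E w \<epsilon> b x * ln (rho_ML k E w \<epsilon> b x)) has_real_derivative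
        r' \<epsilon> x * ln (rho_ML k E w \<epsilon> \<beta> x) + r' \<epsilon> x) (at \<beta>)" for x
      using rho_pos[of x]
      by (auto intro!: derivative_eq_intros rho')
    then have "((\<lambda>b. S_ML k E w \<epsilon> b) has_real_derivative
        - (\<Sum>x\<in>UNIV. r' \<epsilon> x * ln (rho_ML k E w \<epsilon> \<beta> x) + r' \<epsilon> x)) (at \<beta>)"
      unfolding S_ML_def by (intro DERIV_minus DERIV_sum)
    also have "(\<Sum>x\<in>UNIV. r' \<epsilon> x * ln (rho_ML k E w \<epsilon> \<beta> x) + r' \<epsilon> x)
      = (\<Sum>x\<in>UNIV. r' \<epsilon> x * ln (1 - \<epsilon> * c x) - \<beta> * (E x * r' \<epsilon> x) + (1 - ln Z) * r' \<epsilon> x)"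
      unfolding ln_rho by (intro sum.cong) (auto simp: algebra_simps)
    also have "\<dots> = (\<Sum>x\<in>UNIV. r' \<epsilon> x * ln (1 - \<epsilon> * c x)) - \<beta> * (\<Sum>x\<in>UNIV. E x * r' \<epsilon> x)"
      by (simp add: sum.distrib sum_subtractf sum_distrib_left[symmetric] sum_r')
    finally show ?thesis
      by simp
  qed
  \<comment> \<open>Since \<open>deriv\<close> is total, existence of the derivatives needs its own
    proof.\<close>
  have diff: "\<forall>\<^sub>F \<epsilon> in at 0.
      (\<lambda>b. energy_ML k E w \<epsilon> b) field_differentiable at \<beta> \<and>
      (\<lambda>b. S_ML k E w \<epsilon> b) field_differentiable at \<beta>"
    using small
  proof eventually_elim
    case (elim \<epsilon>)
    then show ?case
      using energy' S' unfolding field_differentiable_def by blast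
  qed
  \<comment> \<open>The exact discrepancy for small \<epsilon>, grouped so that each summand is
    visibly quadratic: a Taylor remainder and \<epsilon> times a logarithm of order
    \<epsilon>.\<close>
  define R where "R \<epsilon> = - \<beta> * (\<Sum>x\<in>UNIV. g' x * (ln (1 - \<epsilon> * c x) + \<epsilon> * c x)
      - D x * (\<epsilon> * ln (1 - \<epsilon> * c x)))" for \<epsilon>
  \<comment> \<open>The part of \<open>g'\<close> carrying the mean energy drops out because
    \<open>c\<close> has mean zero.\<close>
  have g'_c: "(\<Sum>x\<in>UNIV. g' x * c x) = - (\<Sum>x\<in>UNIV. E x * (?g x * c x))"
  proof -
    have "(\<Sum>x\<in>UNIV. g' x * c x) = (\<Sum>x\<in>UNIV. mean ?g E * (c x * ?g x) - E x * (?g x * c x))"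
      unfolding g'_def by (intro sum.cong) (auto simp: algebra_simps)
    then show ?thesis
      by (simp add: sum_subtractf sum_distrib_left[symmetric] mean_c)
  qed
  have eq: "C_ML k E w \<epsilon> \<beta> - (- \<beta> * deriv (\<lambda>b. S_ML k E w \<epsilon> b) \<beta>) = R \<epsilon>"
    if pos: "\<forall>x. 0 < 1 - \<epsilon> * c x" for \<epsilon>
  proof -
    have "mean ?g E - energy_ML k E w \<epsilon> \<beta> = \<epsilon> * (\<Sum>x\<in>UNIV. E x * (?g x * c x))"
      unfolding energy_ML_def mean_def rho[OF \<open>0 < \<beta>\<close>] c_def sum_subtractf[symmetric] sum_distrib_left
      by (intro sum.cong) (auto simp: algebra_simps)
    then have energy_gap: "mean ?g E - energy_ML k E w \<epsilon> \<beta> = - (\<Sum>x\<in>UNIV. g' x * (\<epsilon> * c x))"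
      using g'_c by (simp add: sum_distrib_left[symmetric] mult.left_commute)
    \<comment> \<open>The energy gap is exactly linear in \<epsilon> and supplies the term that
      completes \<open>ln (1 - \<epsilon> * c x)\<close> to its second-order remainder.\<close>
    have "R \<epsilon> = - \<beta> * ((\<Sum>x\<in>UNIV. r' \<epsilon> x * ln (1 - \<epsilon> * c x)) + (\<Sum>x\<in>UNIV. g' x * (\<epsilon> * c x)))"
      unfolding R_def r'_def sum.distrib[symmetric]
      by (intro arg_cong2[where f = "(*)"] sum.cong) (auto simp: algebra_simps)
    then show ?thesis
      unfolding C_ML_def energy_gap DERIV_imp_deriv[OF energy'] DERIV_imp_deriv[OF S'[OF pos]]
      by (simp add: algebra_simps power2_eq_square)
  qed
  have R_bigo:
    "(\<lambda>\<epsilon>. g' x * (ln (1 - \<epsilon> * c x) + \<epsilon> * c x)) \<in> O[at 0](\<lambda>\<epsilon>. \<epsilon>\<^sup>2)"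
    "(\<lambda>\<epsilon>. D x * (\<epsilon> * ln (1 - \<epsilon> * c x))) \<in> O[at 0](\<lambda>\<epsilon>. \<epsilon>\<^sup>2)" for x
    using ln_one_minus_bigo[of "c x"]
    by (auto intro!: landau_o.big.mult simp: power2_eq_square)
  have "(\<lambda>\<epsilon>. \<Sum>x\<in>UNIV. g' x * (ln (1 - \<epsilon> * c x) + \<epsilon> * c x)
      - D x * (\<epsilon> * ln (1 - \<epsilon> * c x))) \<in> O[at 0](\<lambda>\<epsilon>. \<epsilon>\<^sup>2)"
    by (rule big_sum_in_bigo, rule sum_in_bigo(2), (rule R_bigo)+)
  then have R: "R \<in> O[at 0](\<lambda>\<epsilon>. \<epsilon>\<^sup>2)"
    unfolding R_def by simp
  have "\<forall>\<^sub>F \<epsilon> in at 0. C_ML k E w \<epsilon> \<beta> - (- \<beta> * deriv (\<lambda>b. S_ML k E w \<epsilon> b) \<beta>) = R \<epsilon>"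
    using small by (rule eventually_mono) (rule eq)
  from diff iffD2[OF landau_o.big.in_cong[OF this] R] show ?thesis ..
qed

end
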